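(* For the envy-free share, and hence also for the cake-cutting share, $\alpha(n,\cdot)=O(\sqrt{n})$. That is, there is an absolute constant $K>0$ such that for all integers $n,m\ge 1$ and every fair division instance $\mathcal{I}=\langle [n],[m],V\rangle$, there is an allocation $\mathcal{A}=(A_1,\dots,A_n)\in\mathcal{P}(n,m)$ with $u_i(A_i)\ge \frac{1}{K\sqrt{n}}\,\mathrm{EFS}_i(\mathcal{I})$ for all $i\in[n]$; and likewise there is an allocation with $u_i(A_i)\ge \frac{1}{K\sqrt{n}}\,\mathrm{CCS}_i(\mathcal{I})$ for all $i\in[n]$.
   Context: A fair division instance $\mathcal{I}=\langle [n],[m],V\rangle$ consists of $n$ agents, $m$ homogeneous divisible items, and valuations $V=(v_1,\dots,v_n)$, where $v_{ik}\ge 0$ is agent $i$'s value for all of item $k$. A bundle is a vector $B\in[0,1]^m$, and $u_i(B)=\sum_{k\in[m]} v_{ik}B(k)$. An allocation is a tuple $\mathcal{A}=(A_1,\dots,A_n)$ of bundles with $\sum_{i\in[n]}A_i(k)\le 1$ for every $k\in[m]$; $\mathcal{P}(n,m)$ is the set of all allocations. Envy-free share: $\mathrm{EFS}_i(\mathcal{I})=\max u_i(A_i)$ over all $\mathcal{A}\in\mathcal{P}(n,m)$ such that $u_j(A_i)\le u_j(A_j)$ for all $j\in[n]\setminus\{i\}$. Cake-cutting share: $\mathrm{CCS}_i(\mathcal{I})=\max u_i(A_i)$ over all $\mathcal{A}\in\mathcal{P}(n,m)$ such that $u_j(A_i)\le u_j(A_{j'})$ for all $j,j'\in[n]\setminus\{i\}$.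 For a notion of share assigning a value $s_i(\mathcal{I})$ to each agent, $\alpha(n,m)$ is the smallest $\alpha\ge1$ such that every instance with $n$ agents and $m$ items has an allocation with $u_i(A_i)\ge s_i(\mathcal{I})/\alpha$ for all $i$; $\alpha(n,\cdot)$ is the worst case (supremum) of $\alpha(n,m)$ over all $m$. *)

theory Defs
  imports "HOL-Analysis.Analysis"
begin

text \<open>
  The agents are \<open>{1..n}\<close> and the items are \<open>{1..m}\<close>. Valuation profiles \<open>v\<close> and allocations \<open>A\<close>
  are total functions of an agent and an item; the entries outside \<open>{1..n} \<times> {1..m}\<close> are
  unconstrained and no definition below depends on them. The sizes \<open>n\<close> and \<open>m\<close> are numbers and not
  types, so that a constant can be chosen before them.
\<close>

definition fair_division_instance :: "nat \<Rightarrow> nat \<Rightarrow> (nat \<Rightarrow> nat \<Rightarrow> real) \<Rightarrow> bool" where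
  "fair_division_instance n m v \<longleftrightarrow> (\<forall>i\<in>{1..n}. \<forall>k\<in>{1..m}. v i k \<ge> 0)"

definition is_bundle :: "nat \<Rightarrow> (nat \<Rightarrow> real) \<Rightarrow> bool" where
  "is_bundle m B \<longleftrightarrow> (\<forall>k\<in>{1..m}. 0 \<le> B k \<and> B k \<le> 1)"

definition utility :: "nat \<Rightarrow> (nat \<Rightarrow> nat \<Rightarrow> real) \<Rightarrow> nat \<Rightarrow> (nat \<Rightarrow> real) \<Rightarrow> real" where
  "utility m v i B = (\<Sum>k\<in>{1..m}. v i k * B k)"

definition allocations :: "nat \<Rightarrow> nat \<Rightarrow> (nat \<Rightarrow> nat \<Rightarrow> real) set" where
  "allocations n m = {A. (\<forall>i\<in>{1..n}. is_bundle m (A i)) \<and> (\<forall>k\<in>{1..m}. (\<Sum>i\<in>{1..n}. A i k) \<le> 1)}"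

definition EFS_feasible ::
    "nat \<Rightarrow> nat \<Rightarrow> (nat \<Rightarrow> nat \<Rightarrow> real) \<Rightarrow> nat \<Rightarrow> (nat \<Rightarrow> nat \<Rightarrow> real) set" where
  "EFS_feasible n m v i =
     {A \<in> allocations n m. \<forall>j\<in>{1..n} - {i}. utility m v j (A i) \<le> utility m v j (A j)}"

definition CCS_feasible ::
    "nat \<Rightarrow> nat \<Rightarrow> (nat \<Rightarrow> nat \<Rightarrow> real) \<Rightarrow> nat \<Rightarrow> (nat \<Rightarrow> nat \<Rightarrow> real) set" where
  "CCS_feasible n m v i =
     {A \<in> allocations n m. \<forall>j\<in>{1..n} - {i}. \<forall>j'\<in>{1..n} - {i}.
        utility m v j (A i) \<le> utility m v j (A j')}"

text \<open>
  The shares are maxima over infinite sets, written as suprema; the lemmas \<open>EFS_is_max\<close> and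
  \<open>CCS_is_max\<close> show that the suprema are attained.
\<close>

definition EFS :: "nat \<Rightarrow> nat \<Rightarrow> (nat \<Rightarrow> nat \<Rightarrow> real) \<Rightarrow> nat \<Rightarrow> real" where
  "EFS n m v i = (SUP A\<in>EFS_feasible n m v i. utility m v i (A i))"

definition CCS :: "nat \<Rightarrow> nat \<Rightarrow> (nat \<Rightarrow> nat \<Rightarrow> real) \<Rightarrow> nat \<Rightarrow> real" where
  "CCS n m v i = (SUP A\<in>CCS_feasible n m v i. utility m v i (A i))"

text \<open>
  A notion of share is a function \<open>s\<close> of the same type as \<open>EFS\<close> and \<open>CCS\<close>. The approximation
  factors are extended reals, so that they are \<open>\<infinity>\<close> when no finite factor works for all instances.
\<close>

definition share_approx ::
    "(nat \<Rightarrow> nat \<Rightarrow> (nat \<Rightarrow> nat \<Rightarrow> real) \<Rightarrow> nat \<Rightarrow> real) \<Rightarrow> nat \<Rightarrow> nat \<Rightarrow> ereal" where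
  "share_approx s n m =
     Inf {ereal a | a :: real. a \<ge> 1 \<and> (\<forall>v. fair_division_instance n m v \<longrightarrow>
            (\<exists>A\<in>allocations n m. \<forall>i\<in>{1..n}. utility m v i (A i) \<ge> s n m v i / a))}"

definition worst_share_approx ::
    "(nat \<Rightarrow> nat \<Rightarrow> (nat \<Rightarrow> nat \<Rightarrow> real) \<Rightarrow> nat \<Rightarrow> real) \<Rightarrow> nat \<Rightarrow> ereal" where
  "worst_share_approx s n = (SUP m\<in>{1..}. share_approx s n m)"

lemma compact_PiE_UNIV:
  fixes X :: "'a \<Rightarrow> 'b::topological_space set"
  assumes "\<And>i. compact (X i)"
  shows "compact (\<Pi>\<^sub>E i\<in>UNIV. X i)"
  using assms compactin_PiE[of "\<lambda>_. euclidean" UNIV X]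
  by (simp add: euclidean_product_topology)

lemma closed_Collect_ball:
  assumes "\<And>i. i \<in> I \<Longrightarrow> closed {x. P i x}"
  shows "closed {x. \<forall>i\<in>I. P i x}"
proof -
  have "{x. \<forall>i\<in>I. P i x} = (\<Inter>i\<in>I. {x. P i x})" by auto
  with assms show ?thesis by auto
qed

lemma attains_max_if_closed:
  fixes v :: "nat \<Rightarrow> nat \<Rightarrow> real"
  assumes i: "i \<in> {1..n}"
    and F: "F = {A \<in> allocations n m. \<forall>(j, a, b)\<in>T. utility m v j (A a) \<le> utility m v j (A b)}"
    and T: "\<And>j a b. (j, a, b) \<in> T \<Longrightarrow> a \<in> {1..n} \<and> b \<in> {1..n}"
  shows "\<exists>A\<in>F. (\<forall>A'\<in>F. utility m v i (A' i) \<le> utility m v i (A i)) \<and>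
           (SUP A\<in>F. utility m v i (A i)) = utility m v i (A i)"
proof -
  define S :: "(nat \<Rightarrow> nat \<Rightarrow> real) set" where
    "S = (\<Pi>\<^sub>E p\<in>UNIV. \<Pi>\<^sub>E k\<in>UNIV. if p \<in> {1..n} \<and> k \<in> {1..m} then {0..1} else {0})"
  define trunc :: "(nat \<Rightarrow> nat \<Rightarrow> real) \<Rightarrow> nat \<Rightarrow> nat \<Rightarrow> real" where
    "trunc = (\<lambda>A p k. if p \<in> {1..n} \<and> k \<in> {1..m} then A p k else 0)"
  have "compact S"
    unfolding S_def by (intro compact_PiE_UNIV) auto
  have coord: "continuous_on UNIV (\<lambda>A :: nat \<Rightarrow> nat \<Rightarrow> real. A p k)" for p k
    by (rule continuous_on_product_then_coordinatewise[OF continuous_on_product_coordinates])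
  have cont: "continuous_on UNIV (\<lambda>A :: nat \<Rightarrow> nat \<Rightarrow> real. utility m v j (A p))" for j p
    unfolding utility_def by (intro continuous_on_sum continuous_on_mult continuous_on_const coord)
  have "closed (allocations n m)"
    unfolding allocations_def is_bundle_def
    by (intro closed_Collect_conj closed_Collect_ball closed_Collect_le
        continuous_on_sum continuous_on_const coord)
  moreover have "closed {A. \<forall>(j, a, b)\<in>T. utility m v j (A a) \<le> utility m v j (A b)}"
    unfolding case_prod_beta by (intro closed_Collect_ball closed_Collect_le cont)
  ultimately have "closed F"
    unfolding F by (auto simp: Collect_conj_eq intro: closed_Int)
  with \<open>compact S\<close> have "compact (S \<inter> F)"
    by (simp add: compact_Int_closed)
  moreover have "(\<lambda>_ _. 0) \<in> S \<inter> F"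
    by (auto simp: S_def F allocations_def is_bundle_def utility_def PiE_iff)
  ultimately obtain A where A: "A \<in> S \<inter> F"
      "\<And>A'. A' \<in> S \<inter> F \<Longrightarrow> utility m v i (A' i) \<le> utility m v i (A i)"
    using continuous_attains_sup[of "S \<inter> F" "\<lambda>A. utility m v i (A i)"]
      continuous_on_subset[OF cont] by blast
  have u: "utility m v j (trunc A' p) = utility m v j (A' p)" if "p \<in> {1..n}" for j p A'
    using that by (auto simp: utility_def trunc_def intro!: sum.cong)
  have trunc_S: "trunc A' \<in> S" if "A' \<in> F" for A'
    using that by (auto simp: S_def F PiE_iff trunc_def allocations_def is_bundle_def)
  have "trunc A' \<in> allocations n m" if "A' \<in> allocations n m" for A'
    using that unfolding allocations_def is_bundle_def trunc_def by simp
  moreover have "utility m v j (trunc A' a) \<le> utility m v j (trunc A' b)"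
    if "A' \<in> F" "(j, a, b) \<in> T" for A' j a b
    using that T[OF that(2)] by (auto simp: F u)
  ultimately have "trunc A' \<in> F" if "A' \<in> F" for A'
    using that unfolding F by blast
  then have max: "utility m v i (A' i) \<le> utility m v i (A i)" if "A' \<in> F" for A'
    using A(2)[of "trunc A'"] trunc_S[OF that] that u[OF i] by simp
  then have "(SUP A\<in>F. utility m v i (A i)) = utility m v i (A i)"
    using A(1) by (intro cSup_eq_maximum) auto
  with A(1) max show ?thesis by blast
qed

lemma EFS_is_max:
  assumes "i \<in> {1..n}"
  shows "\<exists>A\<in>EFS_feasible n m v i.
           (\<forall>A'\<in>EFS_feasible n m v i. utility m v i (A' i) \<le> utility m v i (A i)) \<and>
           EFS n m v i = utility m v i (A i)"
  unfolding EFS_def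
  by (rule attains_max_if_closed[where T = "(\<lambda>j. (j, i, j)) ` ({1..n} - {i})"])
    (use assms in \<open>auto simp: EFS_feasible_def\<close>)

lemma CCS_is_max:
  assumes "i \<in> {1..n}"
  shows "\<exists>A\<in>CCS_feasible n m v i.
           (\<forall>A'\<in>CCS_feasible n m v i. utility m v i (A' i) \<le> utility m v i (A i)) \<and>
           CCS n m v i = utility m v i (A i)"
  unfolding CCS_def
  by (rule attains_max_if_closed[where
        T = "(\<lambda>(j, j'). (j, i, j')) ` (({1..n} - {i}) \<times> ({1..n} - {i}))"])
    (use assms in \<open>auto simp: CCS_feasible_def\<close>)

end

theory Submission
  imports Defs
begin

text \<open>
  Fix weights \<open>w \<ge> 0\<close>, put \<open>x i k = w i * v i k\<close>, and let \<open>W = (\<Sum>k. Max i. x i k)\<close> be the maximal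
  weighted welfare. If \<open>B i\<close> is a bundle of agent \<open>i\<close> that no agent envies, then the weighted welfare
  of the witnessing allocation is at least \<open>\<Sum>j. \<Sum>k. x j k * B i k\<close>, so this sum is at most \<open>W\<close>.
  By AM-GM, \<open>2 * x i k * B i k \<le> sqrt n * (x i k)\<^sup>2 / V k + V k * B i k / sqrt n\<close> with
  \<open>V k = (\<Sum>j. x j k)\<close>; summing over \<open>i\<close> and \<open>k\<close>, each of the two terms contributes at most
  \<open>sqrt n * W\<close>. Hence \<open>(\<Sum>i. w i * s i) \<le> sqrt n * W\<close> for all weights, and by convexity a single
  allocation gives every agent \<open>s i / sqrt n\<close>.
\<close>

section \<open>From weighted sums to one dominating point\<close>

text \<open>
  A minimizer of the squared distance to the orthant above \<open>t\<close> has distance zero: its deficiency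
  vector is a weight vector, and moving towards a point that satisfies the hypothesis for these
  weights would decrease the distance.
\<close>

lemma dominating_point:
  fixes u :: "'a::topological_space \<Rightarrow> 'i \<Rightarrow> real"
  assumes "finite I" and "compact X" and "X \<noteq> {}"
    and cont: "\<And>i. i \<in> I \<Longrightarrow> continuous_on X (\<lambda>x. u x i)"
    and convex: "\<And>x y e. x \<in> X \<Longrightarrow> y \<in> X \<Longrightarrow> 0 \<le> e \<Longrightarrow> e \<le> 1 \<Longrightarrow>
        \<exists>z\<in>X. \<forall>i\<in>I. u z i = (1 - e) * u x i + e * u y i"
    and weights: "\<And>w. (\<And>i. i \<in> I \<Longrightarrow> 0 \<le> w i) \<Longrightarrow>
        \<exists>x\<in>X. (\<Sum>i\<in>I. w i * t i) \<le> (\<Sum>i\<in>I. w i * u x i)"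
  shows "\<exists>x\<in>X. \<forall>i\<in>I. t i \<le> u x i"
proof -
  have "continuous_on X (\<lambda>x. \<Sum>i\<in>I. (max 0 (t i - u x i))\<^sup>2)"
    by (intro continuous_intros cont)
  then obtain x where x: "x \<in> X"
    and min: "\<And>y. y \<in> X \<Longrightarrow>
        (\<Sum>i\<in>I. (max 0 (t i - u x i))\<^sup>2) \<le> (\<Sum>i\<in>I. (max 0 (t i - u y i))\<^sup>2)"
    using continuous_attains_inf[OF \<open>compact X\<close> \<open>X \<noteq> {}\<close>] by blast
  define w where "w i = max 0 (t i - u x i)" for i
  obtain y where y: "y \<in> X" and wy: "(\<Sum>i\<in>I. w i * t i) \<le> (\<Sum>i\<in>I. w i * u y i)"
    using weights[of w] by (auto simp: w_def)
  define d where "d i = u y i - u x i" for i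
  define S where "S = (\<Sum>i\<in>I. w i * d i)"
  define D where "D = (\<Sum>i\<in>I. (d i)\<^sup>2)"
  have "D \<ge> 0"
    by (auto simp: D_def intro: sum_nonneg)
  \<comment> \<open>Moving from \<open>x\<close> towards \<open>y\<close> by the fraction
    \<open>e\<close> changes the squared distance by at most
    \<open>e * (e * D) - e * (2 * S)\<close>; minimality of \<open>x\<close> makes this bound
    nonnegative.\<close>
  have small: "2 * S \<le> e * D" if e: "0 < e" "e \<le> 1" for e
  proof -
    obtain z where z: "z \<in> X" "\<And>i. i \<in> I \<Longrightarrow> u z i = (1 - e) * u x i + e * u y i"
      using convex[OF x y, of e] e by auto
    have "(\<Sum>i\<in>I. (w i)\<^sup>2) \<le> (\<Sum>i\<in>I. (max 0 (t i - u z i))\<^sup>2)"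
      using min[OF z(1)] by (simp add: w_def)
    also have "\<dots> \<le> (\<Sum>i\<in>I. (w i - e * d i)\<^sup>2)"
    proof (rule sum_mono)
      fix i assume i: "i \<in> I"
      have "t i - u z i = (t i - u x i) - e * d i"
        by (simp add: z(2)[OF i] d_def algebra_simps)
      \<comment> \<open>Here \<open>t i - u x i \<le> w i\<close>, and the absolute value covers the
        truncation at 0.\<close>
      then have "max 0 (t i - u z i) \<le> \<bar>w i - e * d i\<bar>"
        by (auto simp: w_def)
      then show "(max 0 (t i - u z i))\<^sup>2 \<le> (w i - e * d i)\<^sup>2"
        by (metis max.cobounded1 power2_abs power_mono)
    qed
    also have "\<dots> = (\<Sum>i\<in>I. (w i)\<^sup>2) - e * (2 * S) + e * (e * D)"
      unfolding S_def D_def sum_distrib_left sum_subtractf[symmetric] sum.distrib[symmetric]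
      by (intro sum.cong refl) (simp add: power2_eq_square algebra_simps)
    finally have "e * (2 * S) \<le> e * (e * D)"
      by simp
    then show ?thesis
      using e by simp
  qed
  have "S \<le> 0"
  proof (rule ccontr)
    assume "\<not> S \<le> 0"
    then have S: "S > 0" by simp
    show False
    \<comment> \<open>For \<open>S > 0\<close> the bound \<open>small\<close> fails at
      \<open>e = S / D\<close> when this is at most 1, and at \<open>e = 1\<close>
      otherwise.\<close>
    proof (cases "S \<le> D")
      case True
      then show False
        using small[of "S / D"] S by simp
    next
      case False
      then show False
        using small[of 1] S by simp
    qed
  qed
  \<comment> \<open>\<open>w i\<close> vanishes wherever \<open>t i \<le> u x i\<close>, so one of
    its two factors can drop the truncation; the choice of \<open>y\<close> then bounds the sum by
    \<open>S\<close>.\<close>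
  have "(\<Sum>i\<in>I. (w i)\<^sup>2) = (\<Sum>i\<in>I. w i * (t i - u x i))"
    by (intro sum.cong refl) (auto simp: w_def max_def power2_eq_square)
  also have "\<dots> \<le> S"
    using wy by (simp add: S_def d_def algebra_simps sum_subtractf)
  finally have "(\<Sum>i\<in>I. (w i)\<^sup>2) = 0"
    using \<open>S \<le> 0\<close> sum_nonneg[of I "\<lambda>i. (w i)\<^sup>2"] by auto
  then have "\<forall>i\<in>I. w i = 0"
    using \<open>finite I\<close> by (simp add: sum_nonneg_eq_0_iff)
  then have "\<forall>i\<in>I. t i \<le> u x i"
    by (auto simp: w_def max_def split: if_splits)
  with x show ?thesis by blast
qed

section \<open>The square-root bound\<close>

text \<open>After AM-GM, the quadratic terms of each item \<open>k\<close> sum to at most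
  \<open>M k\<close> because \<open>x i k \<le> M k\<close>, and the linear terms of each
  \<open>i\<close> are controlled by \<open>unenvied\<close>. The weight
  \<open>sqrt (card I)\<close> balances the two contributions.\<close>

lemma sum_bundle_values_le:
  fixes x B :: "'i \<Rightarrow> 'k \<Rightarrow> real"
  assumes "finite I" and "I \<noteq> {}"
    and x: "\<And>i k. i \<in> I \<Longrightarrow> k \<in> K \<Longrightarrow> 0 \<le> x i k \<and> x i k \<le> M k"
    and B: "\<And>i k. i \<in> I \<Longrightarrow> k \<in> K \<Longrightarrow> 0 \<le> B i k \<and> B i k \<le> 1"
    and unenvied: "\<And>i. i \<in> I \<Longrightarrow> (\<Sum>j\<in>I. \<Sum>k\<in>K. x j k * B i k) \<le> sum M K"
  shows "(\<Sum>i\<in>I. \<Sum>k\<in>K. x i k * B i k) \<le> sqrt (card I) * sum M K"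
proof -
  define r where "r = sqrt (card I)"
  have r: "r > 0" "card I = r * r"
    using \<open>finite I\<close> \<open>I \<noteq> {}\<close> by (auto simp: r_def card_gt_0_iff)
  define V where "V k = (\<Sum>j\<in>I. x j k)" for k
  have amgm: "2 * (x i k * B i k) \<le> r * ((x i k)\<^sup>2 / V k) + V k * B i k / r"
    if ik: "i \<in> I" "k \<in> K" for i k
  proof (cases "x i k = 0")
    case True
    have "V k \<ge> 0"
      using x ik by (auto simp: V_def intro: sum_nonneg)
    with True show ?thesis
      using r B[OF ik] by simp
  next
    case False
    have "x i k \<le> V k"
      unfolding V_def using x ik \<open>finite I\<close> by (intro member_le_sum) auto
    with False x[OF ik] have V: "V k > 0" by simp
    \<comment> \<open>The complete square is the case \<open>B i k = 1\<close>. Scaling by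
      \<open>B i k\<close> gives the general case, where \<open>B i k \<le> 1\<close> lets the
      quadratic term lose this factor.\<close>
    have "r * ((x i k)\<^sup>2 / V k) + V k / r - 2 * x i k = (r * x i k - V k)\<^sup>2 / (r * V k)"
      using r V by (simp add: field_simps power2_eq_square)
    also have "\<dots> \<ge> 0"
      using r V by simp
    finally have "2 * x i k * B i k \<le> (r * ((x i k)\<^sup>2 / V k) + V k / r) * B i k"
      using B[OF ik] by (intro mult_right_mono) auto
    also have "\<dots> \<le> r * ((x i k)\<^sup>2 / V k) + V k * B i k / r"
      using B[OF ik] r V mult_left_le[of "B i k" "r * ((x i k)\<^sup>2 / V k)"]
      by (simp add: algebra_simps)
    finally show ?thesis by (simp add: mult.assoc)
  qed
  have quadratic: "(\<Sum>i\<in>I. (x i k)\<^sup>2 / V k) \<le> M k" if k: "k \<in> K" for k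
  proof -
    have "(\<Sum>i\<in>I. (x i k)\<^sup>2) \<le> (\<Sum>i\<in>I. M k * x i k)"
      unfolding power2_eq_square using x k by (intro sum_mono mult_right_mono) auto
    also have "\<dots> = M k * V k"
      by (simp add: V_def sum_distrib_left)
    finally have "(\<Sum>i\<in>I. (x i k)\<^sup>2) \<le> M k * V k" .
    moreover have "V k \<ge> 0"
      using x k by (auto simp: V_def intro: sum_nonneg)
    moreover have "M k \<ge> 0"
      using x k \<open>I \<noteq> {}\<close> by fastforce
    ultimately show ?thesis
      \<comment> \<open>For \<open>V k = 0\<close> the quotients are 0 by convention, and
        \<open>M k \<ge> 0\<close> suffices.\<close>
      by (cases "V k = 0") (simp_all add: sum_divide_distrib[symmetric] divide_le_eq)
  qed
  have "2 * (\<Sum>i\<in>I. \<Sum>k\<in>K. x i k * B i k)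
      \<le> (\<Sum>i\<in>I. \<Sum>k\<in>K. r * ((x i k)\<^sup>2 / V k) + V k * B i k / r)"
    unfolding sum_distrib_left using amgm by (intro sum_mono)
  also have "\<dots> = r * (\<Sum>k\<in>K. \<Sum>i\<in>I. (x i k)\<^sup>2 / V k) + (\<Sum>i\<in>I. \<Sum>k\<in>K. V k * B i k) / r"
    by (simp add: sum.distrib sum_distrib_left sum_divide_distrib sum.swap[of _ K I])
  also have "\<dots> \<le> r * sum M K + (\<Sum>i\<in>I. sum M K) / r"
  proof (intro add_mono mult_left_mono divide_right_mono)
    show "(\<Sum>k\<in>K. \<Sum>i\<in>I. (x i k)\<^sup>2 / V k) \<le> sum M K"
      using quadratic by (rule sum_mono)
    show "(\<Sum>i\<in>I. \<Sum>k\<in>K. V k * B i k) \<le> (\<Sum>i\<in>I. sum M K)"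
      using unenvied
      by (intro sum_mono[where K = I]) (simp add: V_def sum_distrib_right sum.swap[of _ K I])
  qed (use r in auto)
  also have "\<dots> = 2 * (r * sum M K)"
    using r by simp
  finally show ?thesis
    by (simp add: r_def)
qed

section \<open>Compactness and convexity of the allocations\<close>

lemma utility_convex_combination:
  "utility m v i (\<lambda>k. a * B k + b * C k) = a * utility m v i B + b * utility m v i C"
  by (simp add: utility_def sum.distrib sum_distrib_left algebra_simps)

lemma continuous_on_coordinate:
  "continuous_on S (\<lambda>A :: nat \<Rightarrow> nat \<Rightarrow> real. A i k)"
  by (rule continuous_on_subset[OF continuous_on_product_then_coordinatewise[OF
        continuous_on_product_coordinates]]) simp

text \<open>
  Entries outside \<open>{1..n} \<times> {1..m}\<close> are unconstrained in \<^const>\<open>allocations\<close>; setting them to zero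
  makes the set compact.
\<close>

definition supported_allocations :: "nat \<Rightarrow> nat \<Rightarrow> (nat \<Rightarrow> nat \<Rightarrow> real) set" where
  "supported_allocations n m =
     {A \<in> allocations n m. \<forall>i k. i \<notin> {1..n} \<or> k \<notin> {1..m} \<longrightarrow> A i k = 0}"

text \<open>By Tychonoff, a product of intervals and singletons is compact; the item constraints cut
  out a closed subset.\<close>

lemma compact_supported_allocations: "compact (supported_allocations n m)"
proof -
  have "supported_allocations n m =
      (\<Pi>\<^sub>E i\<in>UNIV. \<Pi>\<^sub>E k\<in>UNIV. if i \<in> {1..n} \<and> k \<in> {1..m} then {0..1} else {0}) \<inter>
      {A. \<forall>k\<in>{1..m}. (\<Sum>i\<in>{1..n}. A i k) \<le> 1}"
    by (fastforce simp: supported_allocations_def allocations_def is_bundle_def PiE_iff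
        split: if_splits)
  moreover have "closed {A :: nat \<Rightarrow> nat \<Rightarrow> real. \<forall>k\<in>{1..m}. (\<Sum>i\<in>{1..n}. A i k) \<le> 1}"
    by (intro closed_Collect_ball closed_Collect_le continuous_on_sum continuous_on_const
        continuous_on_coordinate)
  ultimately show ?thesis
    by (auto intro!: compact_Int_closed compact_PiE_UNIV)
qed

lemma convex_combination_supported_allocations:
  assumes "A \<in> supported_allocations n m" and "B \<in> supported_allocations n m"
    and "0 \<le> e" and "e \<le> 1"
  shows "(\<lambda>i k. (1 - e) * A i k + e * B i k) \<in> supported_allocations n m"
  using assms
  by (auto simp: supported_allocations_def allocations_def is_bundle_def sum.distrib
      sum_distrib_left[symmetric] intro!: convex_bound_le)

section \<open>Maximal weighted welfare\<close>

lemma sum_max_mult_le: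
  fixes x A :: "'i \<Rightarrow> real"
  assumes "finite I" and "I \<noteq> {}" and "\<And>i. i \<in> I \<Longrightarrow> 0 \<le> x i" and "\<And>i. i \<in> I \<Longrightarrow> 0 \<le> A i"
    and "sum A I \<le> 1"
  shows "(\<Sum>i\<in>I. x i * A i) \<le> (MAX i\<in>I. x i)"
proof -
  have "(\<Sum>i\<in>I. x i * A i) \<le> (\<Sum>i\<in>I. (MAX i\<in>I. x i) * A i)"
    using assms by (intro sum_mono mult_right_mono) auto
  also have "\<dots> = (MAX i\<in>I. x i) * sum A I"
    by (simp add: sum_distrib_left)
  also have "\<dots> \<le> (MAX i\<in>I. x i)"
    using assms by (intro mult_left_le) (auto simp: Max_ge_iff)
  finally show ?thesis .
qed

text \<open>Giving each item \<open>k\<close> as a whole to an agent \<open>g k\<close> of largest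
  weighted value attains all itemwise maxima at once.\<close>

lemma max_welfare_allocation:
  assumes "n \<ge> 1"
  shows "\<exists>A\<in>supported_allocations n m.
    (\<Sum>i\<in>{1..n}. w i * utility m v i (A i)) = (\<Sum>k\<in>{1..m}. MAX i\<in>{1..n}. w i * v i k)"
proof -
  have "(MAX i\<in>{1..n}. w i * v i k) \<in> (\<lambda>i. w i * v i k) ` {1..n}" for k
    using assms by (intro Max_in) auto
  then have "\<exists>i. i \<in> {1..n} \<and> w i * v i k = (MAX i\<in>{1..n}. w i * v i k)" for k
    by (metis (no_types, lifting) imageE)
  then obtain g where g: "\<And>k. g k \<in> {1..n}"
    "\<And>k. w (g k) * v (g k) k = (MAX i\<in>{1..n}. w i * v i k)"
    by metis
  define A :: "nat \<Rightarrow> nat \<Rightarrow> real" where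
    "A i k = (if k \<in> {1..m} \<and> i = g k then 1 else 0)" for i k
  have "A \<in> supported_allocations n m"
    using g(1) by (auto simp: A_def supported_allocations_def allocations_def is_bundle_def)
  moreover have "(\<Sum>i\<in>{1..n}. w i * utility m v i (A i)) =
      (\<Sum>k\<in>{1..m}. \<Sum>i\<in>{1..n}. if i = g k then w i * v i k else 0)"
    unfolding utility_def sum_distrib_left
    by (subst sum.swap) (auto simp: A_def intro!: sum.cong)
  ultimately show ?thesis
    using g by auto
qed

section \<open>Approximating the shares\<close>

text \<open>The case \<open>j' = j\<close> of the cake-cutting condition is the envy-free
  condition.\<close>

lemma CCS_feasible_subset_EFS_feasible: "CCS_feasible n m v i \<subseteq> EFS_feasible n m v i"
  by (auto simp: CCS_feasible_def EFS_feasible_def)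

text \<open>The bundles \<open>C i i\<close> stem from different allocations \<open>C i\<close> and
  need not be jointly feasible. \<open>dominating_point\<close> reduces the claim to one inequality
  per weight vector \<open>w\<close>.\<close>

lemma unenvied_bundles_approx:
  assumes "n \<ge> 1" and inst: "fair_division_instance n m v"
    and C: "\<And>i. i \<in> {1..n} \<Longrightarrow> C i \<in> EFS_feasible n m v i"
  shows "\<exists>A\<in>allocations n m. \<forall>i\<in>{1..n}. utility m v i (C i i) / sqrt n \<le> utility m v i (A i)"
proof -
  have "\<exists>A\<in>supported_allocations n m.
      \<forall>i\<in>{1..n}. utility m v i (C i i) / sqrt n \<le> utility m v i (A i)"
  proof (rule dominating_point)
    show "compact (supported_allocations n m)"
      by (rule compact_supported_allocations)
    have "(\<lambda>_ _. 0) \<in> supported_allocations n m"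
      by (simp add: supported_allocations_def allocations_def is_bundle_def)
    then show "supported_allocations n m \<noteq> {}"
      by blast
    show "continuous_on (supported_allocations n m) (\<lambda>A. utility m v i (A i))" for i
      unfolding utility_def
      by (intro continuous_on_sum continuous_on_mult continuous_on_const continuous_on_coordinate)
    show "\<exists>Z\<in>supported_allocations n m. \<forall>i\<in>{1..n}.
        utility m v i (Z i) = (1 - e) * utility m v i (A i) + e * utility m v i (B i)"
      if "A \<in> supported_allocations n m" "B \<in> supported_allocations n m" "0 \<le> e" "e \<le> 1"
      for A B e
      using convex_combination_supported_allocations[OF that]
      by (intro bexI[rotated]) (auto simp: utility_convex_combination)
  next
    fix w :: "nat \<Rightarrow> real"
    assume w: "\<And>i. i \<in> {1..n} \<Longrightarrow> 0 \<le> w i"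
    define x where "x i k = w i * v i k" for i k
    define M where "M k = (MAX i\<in>{1..n}. x i k)" for k
    have x: "0 \<le> x i k" "x i k \<le> M k" if "i \<in> {1..n}" "k \<in> {1..m}" for i k
      using that w inst by (auto simp: x_def M_def fair_division_instance_def)
    have welfare: "(\<Sum>k\<in>{1..m}. x i k * B k) = w i * utility m v i B" for i B
      by (simp add: x_def utility_def sum_distrib_left mult.assoc)
    have C_alloc: "C i \<in> allocations n m" if "i \<in> {1..n}" for i
      using C[OF that] by (simp add: EFS_feasible_def)
    have unenvied: "(\<Sum>j\<in>{1..n}. \<Sum>k\<in>{1..m}. x j k * C i i k) \<le> sum M {1..m}"
      if i: "i \<in> {1..n}" for i
    proof -
      \<comment> \<open>In \<open>C i\<close> every agent \<open>j\<close> likes its own bundle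
        \<open>C i j\<close> at least as much as \<open>C i i\<close>, and weights preserve
        this.\<close>
      have "(\<Sum>j\<in>{1..n}. \<Sum>k\<in>{1..m}. x j k * C i i k) \<le>
          (\<Sum>j\<in>{1..n}. \<Sum>k\<in>{1..m}. x j k * C i j k)"
      proof (unfold welfare, intro sum_mono mult_left_mono w)
        fix j assume "j \<in> {1..n}"
        then show "utility m v j (C i i) \<le> utility m v j (C i j)"
          using C[OF i] by (cases "j = i") (auto simp: EFS_feasible_def)
      qed
      also have "\<dots> = (\<Sum>k\<in>{1..m}. \<Sum>j\<in>{1..n}. x j k * C i j k)"
        by (rule sum.swap)
      also have "\<dots> \<le> sum M {1..m}"
        unfolding M_def using x C_alloc[OF i] \<open>n \<ge> 1\<close>
        by (intro sum_mono sum_max_mult_le) (auto simp: allocations_def is_bundle_def)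
      finally show ?thesis .
    qed
    have "(\<Sum>i\<in>{1..n}. \<Sum>k\<in>{1..m}. x i k * C i i k) \<le> sqrt (card {1..n}) * sum M {1..m}"
      using \<open>n \<ge> 1\<close> x C_alloc unenvied
      by (intro sum_bundle_values_le) (auto simp: allocations_def is_bundle_def)
    then have "(\<Sum>i\<in>{1..n}. w i * (utility m v i (C i i) / sqrt n)) \<le> sum M {1..m}"
      unfolding welfare times_divide_eq_right sum_divide_distrib[symmetric]
      using \<open>n \<ge> 1\<close> by (simp add: divide_le_eq mult.commute)
    moreover obtain A where "A \<in> supported_allocations n m"
      "(\<Sum>i\<in>{1..n}. w i * utility m v i (A i)) = sum M {1..m}"
      using max_welfare_allocation[OF \<open>n \<ge> 1\<close>, of m w v] unfolding M_def x_def by blast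
    ultimately show "\<exists>A\<in>supported_allocations n m.
        (\<Sum>i\<in>{1..n}. w i * (utility m v i (C i i) / sqrt n)) \<le>
        (\<Sum>i\<in>{1..n}. w i * utility m v i (A i))"
      by (intro bexI[of _ A]) simp_all
  qed simp
  then show ?thesis
    by (auto simp: supported_allocations_def)
qed

lemma EFS_approx:
  assumes "n \<ge> 1" and "fair_division_instance n m v"
  shows "\<exists>A\<in>allocations n m. \<forall>i\<in>{1..n}. EFS n m v i / sqrt n \<le> utility m v i (A i)"
proof -
  have "\<forall>i\<in>{1..n}. \<exists>A. A \<in> EFS_feasible n m v i \<and> EFS n m v i = utility m v i (A i)"
    using EFS_is_max by blast
  then obtain C where C: "\<And>i. i \<in> {1..n} \<Longrightarrow>
      C i \<in> EFS_feasible n m v i \<and> EFS n m v i = utility m v i (C i i)"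
    by metis
  then show ?thesis
    using unenvied_bundles_approx[OF assms, of C] by simp
qed

lemma CCS_approx:
  assumes "n \<ge> 1" and "fair_division_instance n m v"
  shows "\<exists>A\<in>allocations n m. \<forall>i\<in>{1..n}. CCS n m v i / sqrt n \<le> utility m v i (A i)"
proof -
  have "\<forall>i\<in>{1..n}. \<exists>A. A \<in> CCS_feasible n m v i \<and> CCS n m v i = utility m v i (A i)"
    using CCS_is_max by blast
  then obtain C where C: "\<And>i. i \<in> {1..n} \<Longrightarrow>
      C i \<in> CCS_feasible n m v i \<and> CCS n m v i = utility m v i (C i i)"
    by metis
  then have "C i \<in> EFS_feasible n m v i" if "i \<in> {1..n}" for i
    using that CCS_feasible_subset_EFS_feasible by blast
  with C show ?thesis
    using unenvied_bundles_approx[OF assms, of C] by simp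
qed

text \<open>Since \<open>a\<close> is independent of \<open>m\<close>, it is an admissible factor
  for every \<open>m\<close>, hence bounds each infimum and their supremum.\<close>

lemma worst_share_approx_le:
  assumes "a \<ge> 1"
    and "\<And>m v. fair_division_instance n m v \<Longrightarrow>
      \<exists>A\<in>allocations n m. \<forall>i\<in>{1..n}. s n m v i / a \<le> utility m v i (A i)"
  shows "worst_share_approx s n \<le> ereal a"
  unfolding worst_share_approx_def share_approx_def
  using assms by (intro SUP_least Inf_lower) blast

theorem theorem1:
  shows "\<exists>K::real. K > 0 \<and>
    (\<forall>n::nat\<ge>1. worst_share_approx EFS n \<le> ereal (K * sqrt (real n))) \<and>
    (\<forall>n::nat\<ge>1. worst_share_approx CCS n \<le> ereal (K * sqrt (real n))) \<and>
    (\<forall>n m :: nat. \<forall>v :: nat \<Rightarrow> nat \<Rightarrow> real. n \<ge> 1 \<longrightarrow> m \<ge> 1 \<longrightarrow> fair_division_instance n m v \<longrightarrow>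
       (\<exists>A\<in>allocations n m. \<forall>i\<in>{1..n}.
          utility m v i (A i) \<ge> 1 / (K * sqrt (real n)) * EFS n m v i) \<and>
       (\<exists>A\<in>allocations n m. \<forall>i\<in>{1..n}.
          utility m v i (A i) \<ge> 1 / (K * sqrt (real n)) * CCS n m v i))"
\<comment> \<open>The constant \<open>K = 1\<close> works; \<open>n \<ge> 1\<close> ensures that the
  factor \<open>sqrt n\<close> is at least 1.\<close>
proof (intro exI[of _ 1] conjI allI impI)
  fix n :: nat assume "n \<ge> 1"
  then show "worst_share_approx EFS n \<le> ereal (1 * sqrt (real n))"
    by (intro worst_share_approx_le) (use EFS_approx in auto)
next
  fix n :: nat assume "n \<ge> 1"
  then show "worst_share_approx CCS n \<le> ereal (1 * sqrt (real n))"
    by (intro worst_share_approx_le) (use CCS_approx in auto)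
qed (use EFS_approx CCS_approx in auto)

end
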